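(* If $X$ is a quasi-Polish space, then $\mathbf{A}(\mathbf{O}(X))$ with the lower Vietoris topology is homeomorphic to $\mathbf{O}(\mathbf{K}(X))$ with the Scott topology, via the map $\alpha\colon\mathbf{A}(\mathbf{O}(X))\to\mathbf{O}(\mathbf{K}(X))$ and its inverse $\beta\colon\mathbf{O}(\mathbf{K}(X))\to\mathbf{A}(\mathbf{O}(X))$.
   Context: A subset $A$ of a topological space $Y$ is a $\mathbf{\Pi}^0_2$-subset if there are sequences $(U_i)_{i\in\omega}$ and $(V_i)_{i\in\omega}$ of open subsets of $Y$ such that $x\in A$ if and only if for all $i\in\omega$, $x\in U_i$ implies $x\in V_i$. A topological space is quasi-Polish if it is countably based and its topology is induced by a Smyth-complete quasi-metric; equivalently, if it is homeomorphic to a $\mathbf{\Pi}^0_2$-subset of an $\omega$-algebraic domain with the Scott topology (one may always take the domain to be $\mathcal{P}(\omega)$, the powerset of $\omega$ ordered by inclusion, with the Scott topology). For a topological space $Y$: $\mathbf{A}(Y)$ is the set of all closed subsets of $Y$ with the lower Vietoris topology, generated by the sets $\Diamond U=\{A\in\mathbf{A}(Y)\mid A\cap U\neq\emptyset\}$ for $U\subseteq Y$ open. $\mathbf{K}(Y)$ is the set of all compact saturated subsets of $Y$ with the upper Vietoris topology, generated by the sets $\Box U=\{K\in\mathbf{K}(Y)\mid K\subseteq U\}$ for $U\subseteq Y$ open. (Compact: every open cover has a finite subcover. Saturated: equal to the intersection of all its open neighborhoods.) $\mathbf{O}(Y)$ is the lattice of open subsets of $Y$ ordered by inclusion and equipped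 with the Scott topology. The maps are $$\alpha(\mathfrak{A})=\bigcup_{U\in\mathfrak{A}}\Box U,\qquad \beta(\mathcal{U})=\{U\in\mathbf{O}(X)\mid\Box U\subseteq\mathcal{U}\}$$ for $\mathfrak{A}\in\mathbf{A}(\mathbf{O}(X))$ and $\mathcal{U}\in\mathbf{O}(\mathbf{K}(X))$. *)

theory Defs
  imports "HOL-Analysis.Analysis" "HOL-Library.Lub_Glb"
begin

subsection \<open>Quasi-Polish spaces\<close>

text \<open>Quasi-metrics are real-valued and separate points in the \<open>T\<^sub>0\<close> sense. The open ball around
  \<open>x\<close> consists of the \<open>y\<close> with \<open>d x y < \<epsilon>\<close>; the order of the arguments of \<open>d\<close> there and in the
  Cauchy condition matters.\<close>

definition quasi_metric_on :: "'a set \<Rightarrow> ('a \<Rightarrow> 'a \<Rightarrow> real) \<Rightarrow> bool" where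
  "quasi_metric_on M d \<longleftrightarrow>
     (\<forall>x\<in>M. \<forall>y\<in>M. 0 \<le> d x y) \<and>
     (\<forall>x\<in>M. \<forall>y\<in>M. x = y \<longleftrightarrow> d x y = 0 \<and> d y x = 0) \<and>
     (\<forall>x\<in>M. \<forall>y\<in>M. \<forall>z\<in>M. d x z \<le> d x y + d y z)"

definition quasi_metric_induces :: "('a \<Rightarrow> 'a \<Rightarrow> real) \<Rightarrow> 'a topology \<Rightarrow> bool" where
  "quasi_metric_induces d X \<longleftrightarrow>
     (\<forall>U. openin X U \<longleftrightarrow>
        U \<subseteq> topspace X \<and> (\<forall>x\<in>U. \<exists>\<epsilon>>0. {y \<in> topspace X. d x y < \<epsilon>} \<subseteq> U))"

definition quasi_Cauchy :: "('a \<Rightarrow> 'a \<Rightarrow> real) \<Rightarrow> (nat \<Rightarrow> 'a) \<Rightarrow> bool" where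
  "quasi_Cauchy d \<sigma> \<longleftrightarrow> (\<forall>\<epsilon>>0. \<exists>N. \<forall>n\<ge>N. \<forall>m\<ge>n. d (\<sigma> n) (\<sigma> m) < \<epsilon>)"

text \<open>Cauchy sequences are required to converge with respect to the symmetrised metric
  \<open>max (d x y) (d y x)\<close>, not just in the topology induced by \<open>d\<close>.\<close>

definition Smyth_complete_on :: "'a set \<Rightarrow> ('a \<Rightarrow> 'a \<Rightarrow> real) \<Rightarrow> bool" where
  "Smyth_complete_on M d \<longleftrightarrow>
     (\<forall>\<sigma>. range \<sigma> \<subseteq> M \<and> quasi_Cauchy d \<sigma> \<longrightarrow>
        (\<exists>x\<in>M. (\<lambda>n. max (d x (\<sigma> n)) (d (\<sigma> n) x)) \<longlonglongrightarrow> 0))"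

definition quasi_Polish_space :: "'a topology \<Rightarrow> bool" where
  "quasi_Polish_space X \<longleftrightarrow>
     second_countable X \<and>
     (\<exists>d. quasi_metric_on (topspace X) d \<and> Smyth_complete_on (topspace X) d \<and>
          quasi_metric_induces d X)"

subsection \<open>The Scott topology\<close>

definition directed_set :: "'a::order set \<Rightarrow> bool" where
  "directed_set D \<longleftrightarrow> D \<noteq> {} \<and> (\<forall>x\<in>D. \<forall>y\<in>D. \<exists>z\<in>D. x \<le> z \<and> y \<le> z)"

text \<open>\<open>L\<close> carries the order restricted from the type, and suprema are taken within \<open>L\<close>.\<close>

definition Scott_open :: "'a::order set \<Rightarrow> 'a set \<Rightarrow> bool" where
  "Scott_open L W \<longleftrightarrow>
     W \<subseteq> L \<and>
     (\<forall>x\<in>W. \<forall>y\<in>L. x \<le> y \<longrightarrow> y \<in> W) \<and>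
     (\<forall>D s. D \<subseteq> L \<and> directed_set D \<and> isLub L D s \<and> s \<in> W \<longrightarrow> D \<inter> W \<noteq> {})"

definition Scott_topology :: "'a::order set \<Rightarrow> 'a topology" where
  "Scott_topology L = topology (Scott_open L)"

lemma Scott_open_subset: "Scott_open L W \<Longrightarrow> W \<subseteq> L"
  by (simp add: Scott_open_def)

lemma Scott_open_upward: "\<lbrakk>Scott_open L W; x \<in> W; y \<in> L; x \<le> y\<rbrakk> \<Longrightarrow> y \<in> W"
  by (simp add: Scott_open_def)

lemma Scott_open_directed:
  "\<lbrakk>Scott_open L W; D \<subseteq> L; directed_set D; isLub L D s; s \<in> W\<rbrakk> \<Longrightarrow> \<exists>x. x \<in> D \<and> x \<in> W"
  unfolding Scott_open_def by (metis disjoint_iff)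

lemma Scott_openI:
  assumes "W \<subseteq> L"
    and "\<And>x y. \<lbrakk>x \<in> W; y \<in> L; x \<le> y\<rbrakk> \<Longrightarrow> y \<in> W"
    and "\<And>D s. \<lbrakk>D \<subseteq> L; directed_set D; isLub L D s; s \<in> W\<rbrakk> \<Longrightarrow> \<exists>x. x \<in> D \<and> x \<in> W"
  shows "Scott_open L W"
  unfolding Scott_open_def disjoint_iff using assms by metis

lemma istopology_Scott_open: "istopology (Scott_open L)"
  unfolding istopology_def
proof (intro conjI allI impI)
  fix S T assume S: "Scott_open L S" and T: "Scott_open L T"
  show "Scott_open L (S \<inter> T)"
  proof (rule Scott_openI)
    show "S \<inter> T \<subseteq> L" using Scott_open_subset[OF S] by auto
  next
    fix x y assume "x \<in> S \<inter> T" "y \<in> L" "x \<le> y"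
    then show "y \<in> S \<inter> T" using Scott_open_upward[OF S] Scott_open_upward[OF T] by (metis Int_iff)
  next
    fix D s assume D: "D \<subseteq> L" "directed_set D" "isLub L D s" and s: "s \<in> S \<inter> T"
    obtain x where x: "x \<in> D" "x \<in> S" using Scott_open_directed[OF S D] s by auto
    obtain y where y: "y \<in> D" "y \<in> T" using Scott_open_directed[OF T D] s by auto
    obtain z where z: "z \<in> D" "x \<le> z" "y \<le> z"
      using D(2) x(1) y(1) unfolding directed_set_def by meson
    have "z \<in> L" using z(1) D(1) by (rule subsetD[rotated])
    then have "z \<in> S" "z \<in> T"
      using Scott_open_upward[OF S x(2)] Scott_open_upward[OF T y(2)] z by simp_all
    then show "\<exists>x. x \<in> D \<and> x \<in> S \<inter> T" using z(1) by auto
  qed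
next
  fix \<K> assume *: "\<forall>K\<in>\<K>. Scott_open L K"
  show "Scott_open L (\<Union>\<K>)"
  proof (rule Scott_openI)
    show "\<Union>\<K> \<subseteq> L" using * Scott_open_subset by (metis Sup_least)
  next
    fix x y assume "x \<in> \<Union>\<K>" "y \<in> L" "x \<le> y"
    then show "y \<in> \<Union>\<K>" using * Scott_open_upward by (metis UnionE UnionI)
  next
    fix D s assume D: "D \<subseteq> L" "directed_set D" "isLub L D s" and s: "s \<in> \<Union>\<K>"
    then obtain K where K: "K \<in> \<K>" "s \<in> K" by auto
    then obtain x where "x \<in> D" "x \<in> K"
      using Scott_open_directed[OF _ D K(2)] * by auto
    then show "\<exists>x. x \<in> D \<and> x \<in> \<Union>\<K>" using K(1) by auto
  qed
qed

lemma openin_Scott_topology: "openin (Scott_topology L) W \<longleftrightarrow> Scott_open L W"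
  unfolding Scott_topology_def by (simp add: istopology_Scott_open topology_inverse')

lemma topspace_Scott_topology [simp]: "topspace (Scott_topology L) = L"
proof (rule antisym)
  show "topspace (Scott_topology L) \<subseteq> L"
    using openin_topspace[of "Scott_topology L"] openin_Scott_topology Scott_open_subset by metis
  have "Scott_open L L"
    by (rule Scott_openI) (auto simp: directed_set_def)
  then show "L \<subseteq> topspace (Scott_topology L)"
    using openin_Scott_topology openin_subset by metis
qed

subsection \<open>Spaces of open, closed, and compact saturated sets\<close>

definition opens_space :: "'a topology \<Rightarrow> 'a set topology" where
  "opens_space Y = Scott_topology {U. openin Y U}"

definition saturatedin :: "'a topology \<Rightarrow> 'a set \<Rightarrow> bool" where
  "saturatedin Y K \<longleftrightarrow> K = \<Inter>{U. openin Y U \<and> K \<subseteq> U}"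

definition Diamond :: "'a topology \<Rightarrow> 'a set \<Rightarrow> 'a set set" where
  "Diamond Y U = {A. closedin Y A \<and> A \<inter> U \<noteq> {}}"

definition Box :: "'a topology \<Rightarrow> 'a set \<Rightarrow> 'a set set" where
  "Box Y U = {K. compactin Y K \<and> saturatedin Y K \<and> K \<subseteq> U}"

text \<open>The empty closed set lies in no \<open>Diamond Y U\<close>, so the carrier of the lower Vietoris topology
  is given explicitly instead of being the union of the subbase.\<close>

definition lower_Vietoris :: "'a topology \<Rightarrow> 'a set topology" where
  "lower_Vietoris Y =
     topology (arbitrary union_of
       (finite intersection_of (\<lambda>W. \<exists>U. openin Y U \<and> W = Diamond Y U)
        relative_to {A. closedin Y A}))"

definition upper_Vietoris :: "'a topology \<Rightarrow> 'a set topology" where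
  "upper_Vietoris Y =
     topology (arbitrary union_of
       (finite intersection_of (\<lambda>W. \<exists>U. openin Y U \<and> W = Box Y U)
        relative_to {K. compactin Y K \<and> saturatedin Y K}))"

lemma topspace_opens_space [simp]: "topspace (opens_space Y) = {U. openin Y U}"
  by (simp add: opens_space_def)

lemma topspace_lower_Vietoris [simp]: "topspace (lower_Vietoris Y) = {A. closedin Y A}"
  by (simp add: lower_Vietoris_def)

lemma topspace_upper_Vietoris [simp]:
  "topspace (upper_Vietoris Y) = {K. compactin Y K \<and> saturatedin Y K}"
  by (simp add: upper_Vietoris_def)

subsection \<open>The comparison maps\<close>

definition alpha :: "'a topology \<Rightarrow> 'a set set \<Rightarrow> 'a set set" where
  "alpha X \<AA> = (\<Union>U\<in>\<AA>. Box X U)"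

definition beta :: "'a topology \<Rightarrow> 'a set set \<Rightarrow> 'a set set" where
  "beta X \<U> = {U. openin X U \<and> Box X U \<subseteq> \<U>}"

end

theory Submission
  imports Defs
begin

text \<open>Everything rests on consonance: a Scott-open family of open sets containing \<open>U\<close> contains
  all open neighbourhoods of some compact saturated \<open>K \<subseteq> U\<close>. To find \<open>K\<close> in a Smyth-complete
  quasi-metric space, shrink \<open>U\<close> within the family to finite unions of ever smaller balls, each
  ball lying well inside one of the preceding stage, and intersect. Consonance of \<open>X\<close> yields
  \<open>\<beta> \<circ> \<alpha> = id\<close> and the continuity of \<open>\<beta>\<close>; consonance of the finite sums of copies of \<open>X\<close> yields
  the continuity of \<open>\<alpha>\<close>.\<close>

subsection \<open>Scott-open families of open sets\<close>

lemma directed_set_finite_UN_subset: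
  assumes D: "directed_set D" and "finite A" and "\<And>a. a \<in> A \<Longrightarrow> \<exists>V\<in>D. f a \<subseteq> V"
  obtains V where "V \<in> D" "(\<Union>a\<in>A. f a) \<subseteq> V"
proof -
  have "\<exists>V\<in>D. (\<Union>a\<in>A. f a) \<subseteq> V"
    using assms(2,3)
  proof (induction A rule: finite_induct)
    case empty
    then show ?case using D by (auto simp: directed_set_def)
  next
    case (insert a A)
    then obtain V where V: "V \<in> D" "(\<Union>a\<in>A. f a) \<subseteq> V" by auto
    obtain W where W: "W \<in> D" "f a \<subseteq> W" using insert.prems[of a] by auto
    obtain Z where "Z \<in> D" "V \<subseteq> Z" "W \<subseteq> Z"
      using D V(1) W(1) unfolding directed_set_def by blast
    with V W show ?case by (intro bexI[of _ Z]) auto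
  qed
  then show thesis using that by blast
qed

lemma directed_set_image:
  assumes "directed_set D" "mono_on D f"
  shows "directed_set (f ` D)"
  unfolding directed_set_def
proof (intro conjI ballI)
  fix u v assume "u \<in> f ` D" "v \<in> f ` D"
  then obtain x y where "x \<in> D" "y \<in> D" "u = f x" "v = f y" by blast
  moreover from this obtain z where "z \<in> D" "x \<le> z" "y \<le> z"
    using assms(1) unfolding directed_set_def by blast
  ultimately show "\<exists>w\<in>f ` D. u \<le> w \<and> v \<le> w" using mono_onD[OF assms(2)] by blast
qed (use assms(1) in \<open>simp add: directed_set_def\<close>)

lemma directed_set_finite_Unions: "directed_set (Union ` {F. finite F \<and> F \<subseteq> \<C>})"
proof (rule directed_set_image)
  show "directed_set {F. finite F \<and> F \<subseteq> \<C>}"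
    unfolding directed_set_def
  proof (intro conjI ballI)
    fix F G assume "F \<in> {F. finite F \<and> F \<subseteq> \<C>}" "G \<in> {F. finite F \<and> F \<subseteq> \<C>}"
    then show "\<exists>Z\<in>{F. finite F \<and> F \<subseteq> \<C>}. F \<subseteq> Z \<and> G \<subseteq> Z"
      by (intro bexI[of _ "F \<union> G"]) auto
  qed auto
  show "mono_on {F. finite F \<and> F \<subseteq> \<C>} Union" by (rule mono_onI) auto
qed

lemma Union_finite_Unions: "\<Union>(Union ` {F. finite F \<and> F \<subseteq> \<C>}) = \<Union>\<C>"
proof
  show "\<Union>\<C> \<subseteq> \<Union>(Union ` {F. finite F \<and> F \<subseteq> \<C>})"
    by (rule Union_mono) (auto intro: image_eqI[of _ _ "{_}"])
qed auto

lemma isLub_openin_iff: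
  assumes "\<And>U. U \<in> D \<Longrightarrow> openin X U"
  shows "isLub {U. openin X U} D S \<longleftrightarrow> S = \<Union>D"
proof -
  have "openin X (\<Union>D)" using assms by auto
  with assms show ?thesis
    unfolding isLub_def leastP_def isUb_def setle_def setge_def
    by (intro iffI antisym) auto
qed

lemma openin_opens_space_iff:
  "openin (opens_space X) H \<longleftrightarrow>
     (\<forall>U\<in>H. openin X U) \<and> (\<forall>U V. U \<in> H \<and> openin X V \<and> U \<subseteq> V \<longrightarrow> V \<in> H) \<and>
     (\<forall>D. directed_set D \<and> (\<forall>U\<in>D. openin X U) \<and> \<Union>D \<in> H \<longrightarrow> (\<exists>U\<in>D. U \<in> H))"
proof -
  have "(\<forall>D S. D \<subseteq> {U. openin X U} \<and> directed_set D \<and> isLub {U. openin X U} D S \<and> S \<in> H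
            \<longrightarrow> D \<inter> H \<noteq> {}) \<longleftrightarrow>
        (\<forall>D. directed_set D \<and> (\<forall>U\<in>D. openin X U) \<and> \<Union>D \<in> H \<longrightarrow> (\<exists>U\<in>D. U \<in> H))"
    using isLub_openin_iff[of _ X] by (auto simp: subset_iff disjoint_iff)
  then show ?thesis
    unfolding opens_space_def openin_Scott_topology Scott_open_def by auto
qed

lemma openin_opens_spaceI:
  assumes "\<And>U. U \<in> H \<Longrightarrow> openin X U"
    and "\<And>U V. \<lbrakk>U \<in> H; openin X V; U \<subseteq> V\<rbrakk> \<Longrightarrow> V \<in> H"
    and "\<And>D. \<lbrakk>directed_set D; \<And>U. U \<in> D \<Longrightarrow> openin X U; \<Union>D \<in> H\<rbrakk> \<Longrightarrow> \<exists>U\<in>D. U \<in> H"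
  shows "openin (opens_space X) H"
  unfolding openin_opens_space_iff using assms by blast

lemma openin_opens_space_imp_openin: "\<lbrakk>openin (opens_space X) H; U \<in> H\<rbrakk> \<Longrightarrow> openin X U"
  unfolding openin_opens_space_iff by blast

lemma opens_space_superset:
  "\<lbrakk>openin (opens_space X) H; U \<in> H; openin X V; U \<subseteq> V\<rbrakk> \<Longrightarrow> V \<in> H"
  unfolding openin_opens_space_iff by blast

lemma opens_space_directed:
  assumes "openin (opens_space X) H" "directed_set D" "\<And>U. U \<in> D \<Longrightarrow> openin X U" "\<Union>D \<in> H"
  obtains U where "U \<in> D" "U \<in> H"
  using assms unfolding openin_opens_space_iff by blast

lemma opens_space_finite_subcover:
  assumes H: "openin (opens_space X) H" and \<C>: "\<And>C. C \<in> \<C> \<Longrightarrow> openin X C" "\<Union>\<C> \<in> H"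
  obtains F where "finite F" "F \<subseteq> \<C>" "\<Union>F \<in> H"
proof -
  let ?D = "Union ` {F. finite F \<and> F \<subseteq> \<C>}"
  have "openin X U" if "U \<in> ?D" for U using that \<C>(1) by auto
  moreover have "\<Union>?D \<in> H" unfolding Union_finite_Unions by (fact \<C>(2))
  ultimately obtain U where "U \<in> ?D" "U \<in> H"
    by (rule opens_space_directed[OF H directed_set_finite_Unions])
  then show thesis using that by blast
qed

lemma compactin_iff_openin_nbhds:
  "compactin X K \<longleftrightarrow>
     K \<subseteq> topspace X \<and> openin (opens_space X) {U. openin X U \<and> K \<subseteq> U}"
proof (intro iffI conjI; (elim conjE)?)
  assume K: "compactin X K"
  then show "K \<subseteq> topspace X" by (rule compactin_subset_topspace)
  show "openin (opens_space X) {U. openin X U \<and> K \<subseteq> U}"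
  proof (rule openin_opens_spaceI)
    fix D assume D: "directed_set D" "\<And>U. U \<in> D \<Longrightarrow> openin X U"
      and "\<Union>D \<in> {U. openin X U \<and> K \<subseteq> U}"
    then obtain F where F: "finite F" "F \<subseteq> D" "K \<subseteq> \<Union>F"
      using compactinD[OF K, of D] by auto
    obtain U where "U \<in> D" "(\<Union>V\<in>F. V) \<subseteq> U"
      by (rule directed_set_finite_UN_subset[OF D(1) F(1), of "\<lambda>V. V"]) (use F(2) in blast)+
    with F(3) D(2) show "\<exists>U\<in>D. U \<in> {U. openin X U \<and> K \<subseteq> U}"
      by (intro bexI[of _ U]) auto
  qed auto
next
  assume "K \<subseteq> topspace X" and nbhds: "openin (opens_space X) {U. openin X U \<and> K \<subseteq> U}"
  show "compactin X K"
    unfolding compactin_def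
  proof (intro conjI allI impI)
    fix \<C> assume "(\<forall>C\<in>\<C>. openin X C) \<and> K \<subseteq> \<Union>\<C>"
    then have "\<And>C. C \<in> \<C> \<Longrightarrow> openin X C" "\<Union>\<C> \<in> {U. openin X U \<and> K \<subseteq> U}" by auto
    then obtain F where "finite F" "F \<subseteq> \<C>" "\<Union>F \<in> {U. openin X U \<and> K \<subseteq> U}"
      by (rule opens_space_finite_subcover[OF nbhds])
    then show "\<exists>F. finite F \<and> F \<subseteq> \<C> \<and> K \<subseteq> \<Union>F" by auto
  qed fact
qed

lemma openin_opens_space_point_nbhds:
  assumes "x \<in> topspace Y"
  shows "openin (opens_space Y) {V. openin Y V \<and> x \<in> V}"
  using assms compactin_iff_openin_nbhds[of Y "{x}"] by simp

lemma closedin_opens_space_subsets: "closedin (opens_space X) {U. openin X U \<and> U \<subseteq> S}"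
proof -
  have "openin (opens_space X) {U. openin X U \<and> \<not> U \<subseteq> S}"
    by (rule openin_opens_spaceI) auto
  moreover have "{U. openin X U} - {U. openin X U \<and> U \<subseteq> S} = {U. openin X U \<and> \<not> U \<subseteq> S}"
    by auto
  ultimately show ?thesis by (auto simp: closedin_def)
qed

lemma mono_on_opens_if_directed_Union:
  assumes "\<And>D. \<lbrakk>directed_set D; \<And>U. U \<in> D \<Longrightarrow> openin X U\<rbrakk> \<Longrightarrow> f (\<Union>D) = \<Union>(f ` D)"
  shows "mono_on {U. openin X U} f"
proof (rule mono_onI)
  fix U V assume "U \<in> {U. openin X U}" "V \<in> {U. openin X U}" "U \<subseteq> V"
  moreover from this have "directed_set {U, V}" by (auto simp: directed_set_def)
  ultimately have "f (U \<union> V) = f U \<union> f V" using assms[of "{U, V}"] by auto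
  then show "f U \<subseteq> f V" using \<open>U \<subseteq> V\<close> by (auto simp: sup.absorb2)
qed

lemma continuous_map_opens_spaceI:
  assumes f: "\<And>U. openin X U \<Longrightarrow> openin Y (f U)"
    and Union: "\<And>D. \<lbrakk>directed_set D; \<And>U. U \<in> D \<Longrightarrow> openin X U\<rbrakk> \<Longrightarrow> f (\<Union>D) = \<Union>(f ` D)"
  shows "continuous_map (opens_space X) (opens_space Y) f"
  unfolding continuous_map_def
proof (intro conjI allI impI)
  have mono: "mono_on {U. openin X U} f" using Union by (rule mono_on_opens_if_directed_Union)
  fix W assume W: "openin (opens_space Y) W"
  show "openin (opens_space X) {U \<in> topspace (opens_space X). f U \<in> W}"
  proof (rule openin_opens_spaceI)
    fix U V assume "U \<in> {U \<in> topspace (opens_space X). f U \<in> W}" "openin X V" "U \<subseteq> V"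
    then show "V \<in> {U \<in> topspace (opens_space X). f U \<in> W}"
      using opens_space_superset[OF W] f mono_onD[OF mono] by auto
  next
    fix D assume D: "directed_set D" "\<And>U. U \<in> D \<Longrightarrow> openin X U"
      and "\<Union>D \<in> {U \<in> topspace (opens_space X). f U \<in> W}"
    then have "\<Union>(f ` D) \<in> W" by (simp add: Union)
    moreover have "directed_set (f ` D)"
      using D by (intro directed_set_image mono_on_subset[OF mono]) auto
    moreover have "openin Y V" if "V \<in> f ` D" for V using that D(2) f by auto
    ultimately obtain V where "V \<in> f ` D" "V \<in> W"
      using opens_space_directed[OF W] by metis
    then show "\<exists>U\<in>D. U \<in> {U \<in> topspace (opens_space X). f U \<in> W}" using D(2) by auto
  qed auto
qed (use f in auto)

lemma continuous_map_opens_space_directed_Union: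
  assumes f: "continuous_map (opens_space X) (opens_space Y) f"
    and D: "directed_set D" "\<And>U. U \<in> D \<Longrightarrow> openin X U"
  shows "f (\<Union>D) = \<Union>(f ` D)"
proof -
  have f_open: "openin Y (f U)" if "openin X U" for U
    using continuous_map_funspace[OF f] that by (auto simp: Pi_iff)
  have not_below: "openin (opens_space X) {U. openin X U \<and> \<not> f U \<subseteq> S}" for S
  proof -
    have "closedin (opens_space X) {U \<in> topspace (opens_space X). f U \<in> {V. openin Y V \<and> V \<subseteq> S}}"
      using f closedin_opens_space_subsets by (rule closedin_continuous_map_preimage)
    moreover have "{U. openin X U} - {U \<in> topspace (opens_space X). f U \<in> {V. openin Y V \<and> V \<subseteq> S}}
        = {U. openin X U \<and> \<not> f U \<subseteq> S}"
      using f_open by auto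
    ultimately show ?thesis by (auto simp: closedin_def)
  qed
  have "f U \<subseteq> f (\<Union>D)" if "U \<in> D" for U
    using opens_space_superset[OF not_below[of "f (\<Union>D)"], of U "\<Union>D"] D(2) that by blast
  moreover have "f (\<Union>D) \<subseteq> \<Union>(f ` D)"
    using opens_space_directed[OF not_below D, of "\<Union>(f ` D)"] D(2) by blast
  ultimately show ?thesis by blast
qed

lemma continuous_map_opens_space_UN:
  assumes f: "\<And>i. i \<in> I \<Longrightarrow> continuous_map (opens_space X) (opens_space Y) (f i)"
  shows "continuous_map (opens_space X) (opens_space Y) (\<lambda>U. \<Union>i\<in>I. f i U)"
proof (rule continuous_map_opens_spaceI)
  show "openin Y (\<Union>i\<in>I. f i U)" if "openin X U" for U
    using continuous_map_funspace[OF f] that by (intro openin_Union) (auto simp: Pi_iff)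
  show "(\<Union>i\<in>I. f i (\<Union>D)) = (\<Union>U\<in>D. \<Union>i\<in>I. f i U)"
    if "directed_set D" "\<And>U. U \<in> D \<Longrightarrow> openin X U" for D
    using continuous_map_opens_space_directed_Union[OF f that] by auto
qed

lemma continuous_map_opens_space_preimage:
  assumes "continuous_map X Y f"
  shows "continuous_map (opens_space Y) (opens_space X) (\<lambda>V. {x \<in> topspace X. f x \<in> V})"
  by (rule continuous_map_opens_spaceI) (use assms in \<open>auto simp: continuous_map_def\<close>)

subsection \<open>Koenig's lemma\<close>

lemma ex_path_to_level:
  fixes S :: "nat \<Rightarrow> 'a set"
  assumes ne: "\<And>n. S n \<noteq> {}"
    and parent: "\<And>n y. y \<in> S (Suc n) \<Longrightarrow> \<exists>x\<in>S n. R x y"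
  shows "\<exists>f. (\<forall>m. f m \<in> S m) \<and> (\<forall>m<n. R (f m) (f (Suc m)))"
proof -
  have "\<forall>m. \<exists>x. x \<in> S m" using ne by auto
  then obtain g where g: "\<And>m. g m \<in> S m" by metis
  have "\<exists>f. (\<forall>m. f m \<in> S m) \<and> f n = y \<and> (\<forall>m<n. R (f m) (f (Suc m)))" if "y \<in> S n" for y
    using that
  proof (induction n arbitrary: y)
    case 0
    then show ?case by (intro exI[of _ "g(0 := y)"]) (simp add: g)
  next
    case (Suc n)
    then obtain x where x: "x \<in> S n" "R x y" using parent by blast
    then obtain f where "\<forall>m. f m \<in> S m" "f n = x" "\<forall>m<n. R (f m) (f (Suc m))"
      using Suc.IH by blast
    with x Suc.prems show ?case by (intro exI[of _ "f(Suc n := y)"]) (auto simp: less_Suc_eq)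
  qed
  then show ?thesis using g by blast
qed

lemma ex_branch_of_finite_levels:
  fixes S :: "nat \<Rightarrow> 'a set"
  assumes fin: "\<And>n. finite (S n)" and ne: "\<And>n. S n \<noteq> {}"
    and parent: "\<And>n y. y \<in> S (Suc n) \<Longrightarrow> \<exists>x\<in>S n. R x y"
  obtains f where "\<And>n. f n \<in> S n" "\<And>n. R (f n) (f (Suc n))"
proof -
  have "\<forall>n. \<exists>g. (\<forall>m. g m \<in> S m) \<and> (\<forall>m<n. R (g m) (g (Suc m)))"
    using ex_path_to_level[of S R, OF ne parent] by simp
  then obtain g where g: "\<And>n m. g n m \<in> S m"
    and path: "\<And>n m. m < n \<Longrightarrow> R (g n m) (g n (Suc m))"
    by metis
  define agree where "agree m N \<longleftrightarrow> infinite N \<and> (\<exists>x. \<forall>n\<in>N. g n m = x)" for m N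
  have ex_agree: "\<exists>N'. agree m N' \<and> N' \<subseteq> N" if N: "infinite N" for m N
  proof -
    have "finite ((\<lambda>n. g n m) ` N)" using g by (intro finite_subset[OF _ fin[of m]]) auto
    then obtain k where "infinite {n \<in> N. g n m = g k m}"
      using pigeonhole_infinite[OF N] by blast
    then show ?thesis unfolding agree_def by (intro exI[of _ "{n \<in> N. g n m = g k m}"]) auto
  qed
  have "\<exists>A. \<forall>m. agree m (A m) \<and> A (Suc m) \<subseteq> A m"
    using ex_agree[OF infinite_UNIV_nat] ex_agree
    by (intro dependent_nat_choice) (auto simp: agree_def)
  then obtain A where A: "\<And>m. agree m (A m)" "\<And>m. A (Suc m) \<subseteq> A m" by blast
  then obtain f where f: "\<And>m n. n \<in> A m \<Longrightarrow> g n m = f m" unfolding agree_def by metis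
  show thesis
  proof
    fix m
    obtain n where n: "n \<in> A (Suc m)" "m < n"
      using A(1)[of "Suc m"] by (auto simp: agree_def infinite_nat_iff_unbounded)
    then have "g n m = f m" "g n (Suc m) = f (Suc m)" using A(2) f by blast+
    then show "f m \<in> S m" "R (f m) (f (Suc m))" using g[of n m] path[OF n(2)] by auto
  qed
qed

subsection \<open>Formal balls\<close>

text \<open>A pair of a centre and a radius. A formal ball well inside \<open>p\<close> keeps a positive distance from
  the edge of \<open>p\<close>, so that the limit of a sequence of formal balls, each well inside the preceding
  one, still lies in all of them.\<close>

type_synonym 'a formal_ball = "'a \<times> real"

locale quasi_metric_space =
  fixes X :: "'a topology" and d :: "'a \<Rightarrow> 'a \<Rightarrow> real"
  assumes quasi_metric: "quasi_metric_on (topspace X) d"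
    and induces: "quasi_metric_induces d X"
begin

definition qball :: "'a formal_ball \<Rightarrow> 'a set" where
  "qball p = {y \<in> topspace X. d (fst p) y < snd p}"

definition well_inside :: "'a formal_ball \<Rightarrow> 'a formal_ball \<Rightarrow> bool" where
  "well_inside q p \<longleftrightarrow> d (fst p) (fst q) + snd q < snd p"

lemma triangle:
  "\<lbrakk>x \<in> topspace X; y \<in> topspace X; z \<in> topspace X\<rbrakk> \<Longrightarrow> d x z \<le> d x y + d y z"
  using quasi_metric by (simp add: quasi_metric_on_def)

lemma dist_self: "x \<in> topspace X \<Longrightarrow> d x x = 0"
  using quasi_metric by (auto simp: quasi_metric_on_def)

lemma centre_in_qball: "\<lbrakk>fst p \<in> topspace X; 0 < snd p\<rbrakk> \<Longrightarrow> fst p \<in> qball p"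
  by (simp add: qball_def dist_self)

lemma openin_iff_qball:
  "openin X U \<longleftrightarrow> U \<subseteq> topspace X \<and> (\<forall>x\<in>U. \<exists>e>0. qball (x, e) \<subseteq> U)"
  using induces by (simp add: quasi_metric_induces_def qball_def)

lemma qball_subset_if_well_inside:
  assumes "fst p \<in> topspace X" "fst q \<in> topspace X" "well_inside q p"
  shows "qball q \<subseteq> qball p"
proof
  fix y assume y: "y \<in> qball q"
  then have "d (fst p) y \<le> d (fst p) (fst q) + d (fst q) y"
    using assms by (intro triangle) (auto simp: qball_def)
  with y assms(3) show "y \<in> qball p" by (simp add: qball_def well_inside_def)
qed

lemma ex_well_inside:
  assumes "x \<in> qball p" "0 < b"
  obtains e where "0 < e" "e \<le> b" "well_inside (x, e) p"
proof
  let ?e = "min b ((snd p - d (fst p) x) / 2)"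
  show "0 < ?e" "?e \<le> b" "well_inside (x, ?e) p"
    using assms by (auto simp: qball_def well_inside_def min_def field_simps)
qed

lemma openin_qball:
  assumes "fst p \<in> topspace X"
  shows "openin X (qball p)"
  unfolding openin_iff_qball
proof (intro conjI ballI)
  fix x assume x: "x \<in> qball p"
  then obtain e where "0 < e" "well_inside (x, e) p" using ex_well_inside[OF x, of 1] by auto
  then show "\<exists>e>0. qball (x, e) \<subseteq> qball p"
    using qball_subset_if_well_inside[OF assms, of "(x, e)"] x by (auto simp: qball_def)
qed (auto simp: qball_def)

definition shrinking :: "(nat \<Rightarrow> 'a formal_ball) \<Rightarrow> bool" where
  "shrinking f \<longleftrightarrow> (\<forall>n. fst (f n) \<in> topspace X \<and> 0 < snd (f n) \<and> well_inside (f (Suc n)) (f n)) \<and>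
     (\<lambda>n. snd (f n)) \<longlonglongrightarrow> 0"

lemma shrinking_dist_centres:
  assumes f: "shrinking f" and "n \<le> m"
  shows "d (fst (f n)) (fst (f m)) < snd (f n)"
proof -
  have "qball (f m) \<subseteq> qball (f n)"
    using \<open>n \<le> m\<close>
  proof (induction m rule: dec_induct)
    case (step m)
    then show ?case
      using f qball_subset_if_well_inside[of "f m" "f (Suc m)"] by (auto simp: shrinking_def)
  qed simp
  moreover have "fst (f m) \<in> qball (f m)" using f by (simp add: shrinking_def centre_in_qball)
  ultimately show ?thesis by (auto simp: qball_def)
qed

lemma quasi_Cauchy_shrinking_centres:
  assumes f: "shrinking f"
  shows "quasi_Cauchy d (\<lambda>n. fst (f n))"
  unfolding quasi_Cauchy_def
proof (intro allI impI)
  fix e :: real assume "0 < e"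
  then have "\<forall>\<^sub>F n in sequentially. snd (f n) < e"
    using f by (auto simp: shrinking_def dest: order_tendstoD(2))
  then show "\<exists>N. \<forall>n\<ge>N. \<forall>m\<ge>n. d (fst (f n)) (fst (f m)) < e"
    using shrinking_dist_centres[OF f] unfolding eventually_sequentially
    by (meson order_less_trans)
qed

lemma shrinking_limit_in_qball:
  assumes f: "shrinking f" and x: "x \<in> topspace X" and lim: "(\<lambda>n. d (fst (f n)) x) \<longlonglongrightarrow> 0"
  shows "x \<in> qball (f n)"
proof -
  let ?s = "\<lambda>n. fst (f n)"
  have s: "?s m \<in> topspace X" for m using f by (simp add: shrinking_def)
  define gap where "gap = snd (f n) - (d (?s n) (?s (Suc n)) + snd (f (Suc n)))"
  have "0 < gap" using f by (simp add: shrinking_def well_inside_def gap_def)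
  with lim have "\<forall>\<^sub>F m in sequentially. d (?s m) x < gap" by (rule order_tendstoD)
  then obtain m where m: "Suc n \<le> m" "d (?s m) x < gap"
    unfolding eventually_sequentially by (meson linorder_linear order_refl)
  have "d (?s n) x \<le> d (?s n) (?s (Suc n)) + d (?s (Suc n)) x" by (intro triangle s x)
  moreover have "d (?s (Suc n)) x \<le> d (?s (Suc n)) (?s m) + d (?s m) x"
    by (intro triangle s x)
  moreover have "d (?s (Suc n)) (?s m) < snd (f (Suc n))"
    using f m(1) by (rule shrinking_dist_centres)
  ultimately have "d (?s n) x < snd (f n)" using m(2) by (simp add: gap_def)
  then show ?thesis using x by (simp add: qball_def)
qed

lemma shrinking_nbhd_of_limit:
  assumes f: "shrinking f" and lim: "(\<lambda>n. d x (fst (f n))) \<longlonglongrightarrow> 0"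
    and V: "openin X V" "x \<in> V"
  obtains n where "qball (f n) \<subseteq> V"
proof -
  obtain e where e: "0 < e" "qball (x, e) \<subseteq> V" using V by (auto simp: openin_iff_qball)
  have "(\<lambda>n. d x (fst (f n)) + snd (f n)) \<longlonglongrightarrow> 0"
    using tendsto_add[OF lim] f by (fastforce simp: shrinking_def)
  then have "\<forall>\<^sub>F n in sequentially. well_inside (f n) (x, e)"
    unfolding well_inside_def using e(1) by (auto dest: order_tendstoD(2))
  then obtain n where "well_inside (f n) (x, e)"
    using eventually_happens'[OF sequentially_bot] by blast
  moreover have "x \<in> topspace X" using V openin_subset by blast
  ultimately have "qball (f n) \<subseteq> qball (x, e)"
    using f by (intro qball_subset_if_well_inside) (auto simp: shrinking_def)
  then show thesis using e(2) by (intro that) blast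
qed

definition fine_level :: "nat \<Rightarrow> 'a formal_ball set \<Rightarrow> bool" where
  "fine_level n L \<longleftrightarrow>
     finite L \<and> (\<forall>p\<in>L. fst p \<in> topspace X \<and> 0 < snd p \<and> snd p \<le> inverse (real (Suc n)))"

definition refining_levels :: "(nat \<Rightarrow> 'a formal_ball set) \<Rightarrow> bool" where
  "refining_levels L \<longleftrightarrow>
     (\<forall>n. fine_level n (L n) \<and> (\<forall>q\<in>L (Suc n). \<exists>p\<in>L n. well_inside q p))"

lemma qball_subset_level:
  assumes "\<And>p. p \<in> A \<Longrightarrow> fst p \<in> topspace X" "fine_level n L" "\<forall>q\<in>L. \<exists>p\<in>A. well_inside q p"
  shows "\<Union>(qball ` L) \<subseteq> \<Union>(qball ` A)"
proof (rule UN_least)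
  fix q assume q: "q \<in> L"
  then obtain p where p: "p \<in> A" "well_inside q p" using assms(3) by blast
  have "fst q \<in> topspace X" using assms(2) q by (simp add: fine_level_def)
  then have "qball q \<subseteq> qball p" using assms(1) p by (intro qball_subset_if_well_inside)
  with p(1) show "qball q \<subseteq> \<Union>(qball ` A)" by blast
qed

lemma ex_finer_level:
  assumes H: "openin (opens_space X) H" and A: "\<And>p. p \<in> A \<Longrightarrow> fst p \<in> topspace X"
    and "\<Union>(qball ` A) \<in> H"
  shows "\<exists>L. fine_level n L \<and> \<Union>(qball ` L) \<in> H \<and> (\<forall>q\<in>L. \<exists>p\<in>A. well_inside q p)"
proof -
  let ?N = "{q. fst q \<in> topspace X \<and> 0 < snd q \<and> snd q \<le> inverse (real (Suc n)) \<and>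
    (\<exists>p\<in>A. well_inside q p)}"
  have open_N: "openin X C" if "C \<in> qball ` ?N" for C using that openin_qball by auto
  have "\<Union>(qball ` A) \<subseteq> \<Union>(qball ` ?N)"
  proof
    fix x assume "x \<in> \<Union>(qball ` A)"
    then obtain p where p: "p \<in> A" "x \<in> qball p" by blast
    then obtain e where e: "0 < e" "e \<le> inverse (real (Suc n))" "well_inside (x, e) p"
      using ex_well_inside[OF p(2), of "inverse (real (Suc n))"] by auto
    moreover have "x \<in> topspace X" using p(2) by (simp add: qball_def)
    ultimately have "(x, e) \<in> ?N" "x \<in> qball (x, e)" using p(1) centre_in_qball[of "(x, e)"] by auto
    then show "x \<in> \<Union>(qball ` ?N)" by blast
  qed
  then have "\<Union>(qball ` ?N) \<in> H" using opens_space_superset[OF H assms(3)] open_N by blast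
  then obtain F where F: "finite F" "F \<subseteq> qball ` ?N" "\<Union>F \<in> H"
    using opens_space_finite_subcover[OF H open_N] by blast
  obtain L where "L \<subseteq> ?N" "finite L" "F = qball ` L"
    using finite_subset_image[OF F(1,2)] by auto
  then show ?thesis using F(3) by (intro exI[of _ L]) (auto simp: fine_level_def)
qed

lemma ex_refining_levels:
  assumes H: "openin (opens_space X) H" and U: "U \<in> H"
  obtains L where "refining_levels L" "\<And>n. \<Union>(qball ` L n) \<in> H" "\<And>n. \<Union>(qball ` L n) \<subseteq> U"
proof -
  define P where "P n L \<longleftrightarrow> fine_level n L \<and> \<Union>(qball ` L) \<in> H \<and> \<Union>(qball ` L) \<subseteq> U" for n L
  have extend: "\<exists>L. P n L \<and> (\<forall>q\<in>L. \<exists>p\<in>A. well_inside q p)"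
    if A: "\<And>p. p \<in> A \<Longrightarrow> fst p \<in> topspace X" "\<Union>(qball ` A) \<in> H" "\<Union>(qball ` A) \<subseteq> U" for n A
  proof -
    obtain L where L: "fine_level n L" "\<Union>(qball ` L) \<in> H" "\<forall>q\<in>L. \<exists>p\<in>A. well_inside q p"
      using ex_finer_level[OF H A(1,2)] by auto
    have "\<Union>(qball ` L) \<subseteq> U" using qball_subset_level[OF A(1) L(1,3)] A(3) by (rule order_trans)
    with L show ?thesis unfolding P_def by blast
  qed
  have "openin X U" using H U by (rule openin_opens_space_imp_openin)
  then have "\<Union>(qball ` {p. fst p \<in> topspace X \<and> qball p \<subseteq> U}) = U"
    using centre_in_qball unfolding openin_iff_qball by fastforce
  then have "\<exists>L. P 0 L"
    using extend[of "{p. fst p \<in> topspace X \<and> qball p \<subseteq> U}" 0] U by auto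
  moreover have "\<exists>L'. P (Suc n) L' \<and> (\<forall>q\<in>L'. \<exists>p\<in>L. well_inside q p)" if "P n L" for n L
    using that by (intro extend) (auto simp: P_def fine_level_def)
  ultimately obtain L where "\<forall>n. P n (L n) \<and> (\<forall>q\<in>L (Suc n). \<exists>p\<in>L n. well_inside q p)"
    using dependent_nat_choice[of P "\<lambda>_ L L'. \<forall>q\<in>L'. \<exists>p\<in>L. well_inside q p"] by blast
  then show thesis by (intro that[of L]) (simp_all add: P_def refining_levels_def)
qed

lemma refining_levels_branch_shrinking:
  assumes L: "refining_levels L" and "\<And>n. f n \<in> L n" "\<And>n. well_inside (f (Suc n)) (f n)"
  shows "shrinking f"
proof -
  have f: "fst (f n) \<in> topspace X" "0 < snd (f n)" "snd (f n) \<le> inverse (real (Suc n))" for n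
    using assms(1,2) by (auto simp: refining_levels_def fine_level_def)
  have "(\<lambda>n. snd (f n)) \<longlonglongrightarrow> 0"
    by (rule tendsto_sandwich[OF _ _ tendsto_const LIMSEQ_inverse_real_of_nat])
      (intro always_eventually allI less_imp_le f(2), intro always_eventually allI f(3))
  then show ?thesis using f assms(3) by (simp add: shrinking_def)
qed

end

subsection \<open>Consonance\<close>

definition consonant :: "'a topology \<Rightarrow> bool" where
  "consonant X \<longleftrightarrow> (\<forall>H U. openin (opens_space X) H \<and> U \<in> H \<longrightarrow>
     (\<exists>K\<in>Box X U. \<forall>V. openin X V \<and> K \<subseteq> V \<longrightarrow> V \<in> H))"

lemma consonantE:
  assumes "consonant X" "openin (opens_space X) H" "U \<in> H"
  obtains K where "K \<in> Box X U" "\<And>V. \<lbrakk>openin X V; K \<subseteq> V\<rbrakk> \<Longrightarrow> V \<in> H"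
  using assms unfolding consonant_def by meson

locale Smyth_complete_space = quasi_metric_space +
  assumes complete: "Smyth_complete_on (topspace X) d"
begin

lemma shrinking_limit:
  assumes f: "shrinking f"
  obtains x where "\<And>n. x \<in> qball (f n)" "\<And>V. \<lbrakk>openin X V; x \<in> V\<rbrakk> \<Longrightarrow> \<exists>n. qball (f n) \<subseteq> V"
proof -
  let ?s = "\<lambda>n. fst (f n)"
  have "range ?s \<subseteq> topspace X" using f by (auto simp: shrinking_def)
  then obtain x where x: "x \<in> topspace X" and lim: "(\<lambda>n. max (d x (?s n)) (d (?s n) x)) \<longlonglongrightarrow> 0"
    using complete quasi_Cauchy_shrinking_centres[OF f] unfolding Smyth_complete_on_def by blast
  have nonneg: "0 \<le> d x (?s n)" "0 \<le> d (?s n) x" for n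
    using x f quasi_metric by (simp_all add: quasi_metric_on_def shrinking_def)
  have "(\<lambda>n. d x (?s n)) \<longlonglongrightarrow> 0" "(\<lambda>n. d (?s n) x) \<longlonglongrightarrow> 0"
    using nonneg by (intro tendsto_sandwich[OF _ _ tendsto_const lim] always_eventually allI; simp)+
  then show thesis
    using that shrinking_limit_in_qball[OF f x] shrinking_nbhd_of_limit[OF f] by metis
qed

text \<open>By Koenig's lemma, a failing directed cover would yield a shrinking sequence of balls, none
  contained in a member of the cover; its Smyth limit lies in the intersection, hence in some
  member of the cover, and that member swallows a late ball.\<close>

lemma refining_levels_directed_cover:
  assumes L: "refining_levels L" and D: "directed_set D" "\<And>V. V \<in> D \<Longrightarrow> openin X V"
    and cover: "(\<Inter>n. \<Union>(qball ` L n)) \<subseteq> \<Union>D"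
  shows "\<exists>V\<in>D. \<exists>n. \<Union>(qball ` L n) \<subseteq> V"
proof (rule ccontr)
  assume uncovered: "\<not> ?thesis"
  define S where "S n = {p \<in> L n. \<not> (\<exists>V\<in>D. qball p \<subseteq> V)}" for n
  have fin: "finite (L n)" and centre: "p \<in> L n \<Longrightarrow> fst p \<in> topspace X" for n p
    using L by (auto simp: refining_levels_def fine_level_def)
  have "S n \<noteq> {}" for n
  proof
    assume "S n = {}"
    then have "\<exists>V\<in>D. qball p \<subseteq> V" if "p \<in> L n" for p using that unfolding S_def by blast
    then obtain V where "V \<in> D" "\<Union>(qball ` L n) \<subseteq> V"
      by (rule directed_set_finite_UN_subset[OF D(1) fin])
    then show False using uncovered by blast
  qed
  moreover have "\<exists>p\<in>S n. well_inside q p" if q: "q \<in> S (Suc n)" for n q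
  proof -
    have "q \<in> L (Suc n)" using q by (simp add: S_def)
    then obtain p where p: "p \<in> L n" "well_inside q p"
      using L unfolding refining_levels_def by blast
    then have "qball q \<subseteq> qball p"
      using \<open>q \<in> L (Suc n)\<close> by (intro qball_subset_if_well_inside centre)
    then have "p \<in> S n" using p(1) q unfolding S_def by blast
    then show ?thesis using p(2) by blast
  qed
  moreover have "finite (S n)" for n using fin by (simp add: S_def)
  ultimately obtain f where f: "\<And>n. f n \<in> S n" "\<And>n. well_inside (f (Suc n)) (f n)"
    using ex_branch_of_finite_levels[of S "\<lambda>p q. well_inside q p"] by blast
  then have f_L: "f n \<in> L n" for n by (simp add: S_def)
  then have "shrinking f" using f(2) by (rule refining_levels_branch_shrinking[OF L])
  then obtain x where x: "\<And>n. x \<in> qball (f n)" "\<And>V. \<lbrakk>openin X V; x \<in> V\<rbrakk> \<Longrightarrow> \<exists>n. qball (f n) \<subseteq> V"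
    by (rule shrinking_limit) blast
  have "x \<in> \<Union>D" using x(1) f_L cover by blast
  then obtain V where V: "V \<in> D" "x \<in> V" by blast
  then obtain n where "qball (f n) \<subseteq> V" using x(2) D(2) by blast
  then show False using f(1)[of n] V(1) by (auto simp: S_def)
qed

lemma consonant: "consonant X"
  unfolding consonant_def
proof (intro allI impI, elim conjE)
  fix H U assume H: "openin (opens_space X) H" and "U \<in> H"
  then obtain L where L: "refining_levels L"
    and L_H: "\<And>n. \<Union>(qball ` L n) \<in> H" and L_U: "\<And>n. \<Union>(qball ` L n) \<subseteq> U"
    using ex_refining_levels by blast
  define K where "K = (\<Inter>n. \<Union>(qball ` L n))"
  have L_open: "openin X (\<Union>(qball ` L n))" for n
    using H L_H by (rule openin_opens_space_imp_openin)
  have K_L: "K \<subseteq> \<Union>(qball ` L n)" for n unfolding K_def by blast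
  note cover = refining_levels_directed_cover[OF L, folded K_def]
  have "openin (opens_space X) {V. openin X V \<and> K \<subseteq> V}"
  proof (rule openin_opens_spaceI)
    fix D assume D: "directed_set D" "\<And>V. V \<in> D \<Longrightarrow> openin X V"
      and "\<Union>D \<in> {V. openin X V \<and> K \<subseteq> V}"
    then obtain V n where V: "V \<in> D" "\<Union>(qball ` L n) \<subseteq> V" using cover[OF D] by auto
    have "K \<subseteq> V" using K_L V(2) by (rule order_trans)
    then show "\<exists>V\<in>D. V \<in> {V. openin X V \<and> K \<subseteq> V}" using D(2) V(1) by blast
  qed auto
  then have "compactin X K"
    using order_trans[OF K_L openin_subset[OF L_open]] by (simp add: compactin_iff_openin_nbhds)
  moreover have "saturatedin X K"
    unfolding saturatedin_def using L_open K_L by (auto simp: K_def)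
  ultimately have "K \<in> Box X U" using order_trans[OF K_L L_U] by (simp add: Box_def)
  moreover have "V \<in> H" if V: "openin X V" "K \<subseteq> V" for V
  proof -
    have "directed_set {V}" by (simp add: directed_set_def)
    then obtain n where "\<Union>(qball ` L n) \<subseteq> V" using cover[of "{V}"] V by auto
    then show ?thesis by (rule opens_space_superset[OF H L_H V(1)])
  qed
  ultimately show "\<exists>K\<in>Box X U. \<forall>V. openin X V \<and> K \<subseteq> V \<longrightarrow> V \<in> H" by blast
qed

end

subsection \<open>Sums of spaces\<close>

definition sum_dist :: "('i \<Rightarrow> 'a \<Rightarrow> 'a \<Rightarrow> real) \<Rightarrow> 'i \<times> 'a \<Rightarrow> 'i \<times> 'a \<Rightarrow> real" where
  "sum_dist d p q = (if fst p = fst q then min 1 (d (fst p) (snd p) (snd q)) else 1)"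

lemma sum_dist_same: "sum_dist d (i, x) (i, y) = min 1 (d i x y)"
  by (simp add: sum_dist_def)

lemma sum_dist_less_iff:
  "e \<le> 1 \<Longrightarrow> sum_dist d p q < e \<longleftrightarrow> fst p = fst q \<and> d (fst p) (snd p) (snd q) < e"
  by (auto simp: sum_dist_def)

lemma quasi_metric_on_sum_dist:
  assumes d: "\<And>i. i \<in> I \<Longrightarrow> quasi_metric_on (M i) (d i)"
  shows "quasi_metric_on (Sigma I M) (sum_dist d)"
  unfolding quasi_metric_on_def
proof (intro conjI ballI)
  have nonneg: "0 \<le> d i x y" if "i \<in> I" "x \<in> M i" "y \<in> M i" for i x y
    using d[OF that(1)] that(2,3) by (simp add: quasi_metric_on_def)
  fix p q assume p: "p \<in> Sigma I M" and q: "q \<in> Sigma I M"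
  show "0 \<le> sum_dist d p q" using p q nonneg by (auto simp: sum_dist_def)
  show "p = q \<longleftrightarrow> sum_dist d p q = 0 \<and> sum_dist d q p = 0"
  proof (cases "fst p = fst q")
    case True
    then have "snd p = snd q \<longleftrightarrow> d (fst p) (snd p) (snd q) = 0 \<and> d (fst p) (snd q) (snd p) = 0"
      using d[of "fst p"] p q by (auto simp: quasi_metric_on_def)
    then show ?thesis using True by (auto simp: sum_dist_def prod_eq_iff min_def)
  qed (auto simp: sum_dist_def)
  fix r assume r: "r \<in> Sigma I M"
  show "sum_dist d p r \<le> sum_dist d p q + sum_dist d q r"
  proof (cases "fst p = fst q \<and> fst q = fst r")
    case True
    let ?d = "d (fst p)"
    have "?d (snd p) (snd r) \<le> ?d (snd p) (snd q) + ?d (snd q) (snd r)"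
      using d[of "fst p"] p q r True by (auto simp: quasi_metric_on_def)
    moreover have "0 \<le> ?d (snd p) (snd q)" "0 \<le> ?d (snd q) (snd r)"
      using p q r True by (auto intro!: nonneg)
    ultimately show ?thesis using True by (simp add: sum_dist_def min_def)
  next
    case False
    then show ?thesis using p q r nonneg by (auto simp: sum_dist_def)
  qed
qed

lemma ex_sum_dist_ball_subset_iff:
  assumes i: "i \<in> I"
  shows "(\<exists>e>0. {q \<in> Sigma I M. sum_dist d (i, x) q < e} \<subseteq> U) \<longleftrightarrow>
    (\<exists>e>0. {y \<in> M i. d i x y < e} \<subseteq> {y. (i, y) \<in> U})"
proof
  assume "\<exists>e>0. {q \<in> Sigma I M. sum_dist d (i, x) q < e} \<subseteq> U"
  then obtain e where e: "0 < e" "{q \<in> Sigma I M. sum_dist d (i, x) q < e} \<subseteq> U" by blast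
  have "{y \<in> M i. d i x y < e} \<subseteq> {y. (i, y) \<in> U}"
    using e(2) i by (auto simp: sum_dist_same min_less_iff_disj)
  with e(1) show "\<exists>e>0. {y \<in> M i. d i x y < e} \<subseteq> {y. (i, y) \<in> U}" by blast
next
  assume "\<exists>e>0. {y \<in> M i. d i x y < e} \<subseteq> {y. (i, y) \<in> U}"
  then obtain e where e: "0 < e" "{y \<in> M i. d i x y < e} \<subseteq> {y. (i, y) \<in> U}" by blast
  then have "{q \<in> Sigma I M. sum_dist d (i, x) q < min 1 e} \<subseteq> U"
    by (auto simp: sum_dist_def split: if_splits)
  then show "\<exists>e>0. {q \<in> Sigma I M. sum_dist d (i, x) q < e} \<subseteq> U"
    using e(1) by (intro exI[of _ "min 1 e"]) simp
qed

lemma quasi_metric_induces_sum_dist: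
  assumes d: "\<And>i. i \<in> I \<Longrightarrow> quasi_metric_induces (d i) (X i)"
  shows "quasi_metric_induces (sum_dist d) (sum_topology X I)"
proof -
  let ?ball = "\<lambda>p e. {q \<in> Sigma I (topspace \<circ> X). sum_dist d p q < e}"
  have component: "openin (X i) {x. (i, x) \<in> U} \<longleftrightarrow>
      (\<forall>x. (i, x) \<in> U \<longrightarrow> (\<exists>e>0. ?ball (i, x) e \<subseteq> U))"
    if "U \<subseteq> Sigma I (topspace \<circ> X)" "i \<in> I" for U i
    using d[OF \<open>i \<in> I\<close>] that unfolding quasi_metric_induces_def
    by (auto simp: ex_sum_dist_ball_subset_iff)
  have "(\<forall>i\<in>I. openin (X i) {x. (i, x) \<in> U}) \<longleftrightarrow> (\<forall>p\<in>U. \<exists>e>0. ?ball p e \<subseteq> U)"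
    if U: "U \<subseteq> Sigma I (topspace \<circ> X)" for U
  proof -
    have "(\<forall>i\<in>I. openin (X i) {x. (i, x) \<in> U}) \<longleftrightarrow>
        (\<forall>i\<in>I. \<forall>x. (i, x) \<in> U \<longrightarrow> (\<exists>e>0. ?ball (i, x) e \<subseteq> U))"
      using component[OF U] by simp
    also have "\<dots> \<longleftrightarrow> (\<forall>p\<in>U. \<exists>e>0. ?ball p e \<subseteq> U)" using U by blast
    finally show ?thesis .
  qed
  then show ?thesis
    unfolding quasi_metric_induces_def openin_sum_topology topspace_sum_topology by blast
qed

lemma quasi_Cauchy_sum_dist_tail:
  assumes Cauchy: "quasi_Cauchy (sum_dist d) \<sigma>"
  obtains N i s where "\<And>n. \<sigma> (n + N) = (i, s n)" "quasi_Cauchy (d i) s"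
proof -
  obtain N where "\<And>n m. \<lbrakk>N \<le> n; n \<le> m\<rbrakk> \<Longrightarrow> sum_dist d (\<sigma> n) (\<sigma> m) < 1"
    using Cauchy unfolding quasi_Cauchy_def by (metis zero_less_one)
  then have index: "fst (\<sigma> (n + N)) = fst (\<sigma> N)" for n
    by (metis le_add2 order_refl sum_dist_less_iff)
  define i where "i = fst (\<sigma> N)"
  define s where "s n = snd (\<sigma> (n + N))" for n
  have tail: "\<sigma> (n + N) = (i, s n)" for n
    using index[of n] by (simp add: i_def s_def prod_eq_iff)
  have "quasi_Cauchy (d i) s"
    unfolding quasi_Cauchy_def
  proof (intro allI impI)
    fix e :: real assume "0 < e"
    then have "0 < min 1 e" by simp
    then obtain k where k: "\<forall>n\<ge>k. \<forall>m\<ge>n. sum_dist d (\<sigma> n) (\<sigma> m) < min 1 e"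
      using Cauchy unfolding quasi_Cauchy_def by blast
    have "d i (s n) (s m) < e" if "k \<le> n" "n \<le> m" for n m
    proof -
      have "sum_dist d (\<sigma> (n + N)) (\<sigma> (m + N)) < min 1 e" using k that by simp
      then show ?thesis by (auto simp: tail sum_dist_same min_def split: if_splits)
    qed
    then show "\<exists>k. \<forall>n\<ge>k. \<forall>m\<ge>n. d i (s n) (s m) < e" by blast
  qed
  with tail show thesis by (rule that)
qed

lemma Smyth_complete_on_sum_dist:
  assumes d: "\<And>i. i \<in> I \<Longrightarrow> Smyth_complete_on (M i) (d i)"
  shows "Smyth_complete_on (Sigma I M) (sum_dist d)"
  unfolding Smyth_complete_on_def
proof (intro allI impI, elim conjE)
  fix \<sigma> assume \<sigma>: "range \<sigma> \<subseteq> Sigma I M" and "quasi_Cauchy (sum_dist d) \<sigma>"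
  then obtain N i s where tail: "\<And>n. \<sigma> (n + N) = (i, s n)" and s: "quasi_Cauchy (d i) s"
    using quasi_Cauchy_sum_dist_tail by blast
  have "(i, s n) \<in> Sigma I M" for n using \<sigma> unfolding tail[symmetric] by blast
  then have i: "i \<in> I" and "range s \<subseteq> M i" by auto
  then obtain x where x: "x \<in> M i"
    and lim: "(\<lambda>n. max (d i x (s n)) (d i (s n) x)) \<longlonglongrightarrow> 0"
    using d[OF i] s unfolding Smyth_complete_on_def by blast
  have "(\<lambda>n. min 1 (max (d i x (s n)) (d i (s n) x))) \<longlonglongrightarrow> min 1 0"
    by (intro tendsto_min tendsto_const lim)
  moreover have "max (sum_dist d (i, x) (\<sigma> (n + N))) (sum_dist d (\<sigma> (n + N)) (i, x)) =
      min 1 (max (d i x (s n)) (d i (s n) x))" for n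
    by (simp add: tail sum_dist_same max_min_distrib2)
  ultimately have "(\<lambda>n. max (sum_dist d (i, x) (\<sigma> n)) (sum_dist d (\<sigma> n) (i, x))) \<longlonglongrightarrow> 0"
    by (simp add: LIMSEQ_offset[where k = N])
  then show "\<exists>p\<in>Sigma I M. (\<lambda>n. max (sum_dist d p (\<sigma> n)) (sum_dist d (\<sigma> n) p)) \<longlonglongrightarrow> 0"
    using i x by blast
qed

lemma Smyth_complete_space_sum:
  assumes "\<And>i. i \<in> I \<Longrightarrow> Smyth_complete_space (X i) (d i)"
  shows "Smyth_complete_space (sum_topology X I) (sum_dist d)"
proof (intro Smyth_complete_space.intro quasi_metric_space.intro Smyth_complete_space_axioms.intro)
  note X = assms[unfolded Smyth_complete_space_def quasi_metric_space_def
      Smyth_complete_space_axioms_def]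
  show "quasi_metric_on (topspace (sum_topology X I)) (sum_dist d)"
    using X by (simp add: quasi_metric_on_sum_dist)
  show "quasi_metric_induces (sum_dist d) (sum_topology X I)"
    using X by (simp add: quasi_metric_induces_sum_dist)
  show "Smyth_complete_on (topspace (sum_topology X I)) (sum_dist d)"
    using X by (simp add: Smyth_complete_on_sum_dist)
qed

lemma compactin_sum_topology_component:
  assumes K: "compactin (sum_topology X I) K" and i: "i \<in> I"
  shows "compactin (X i) {x \<in> topspace (X i). (i, x) \<in> K}"
proof -
  have "proper_map (X i) (sum_topology X I) (Pair i)"
    using closed_map_component_injection[OF i]
    by (simp add: injective_imp_proper_eq_closed_map inj_on_def)
  then show ?thesis using K by (rule compactin_proper_map_preimage)
qed

text \<open>The Scott topology of a product may be finer than the product of the Scott topologies, so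
  consonance of the single spaces would not allow shrinking all \<open>U i\<close> simultaneously.\<close>

lemma consonant_sum_shrinking:
  assumes cons: "consonant (sum_topology X I)"
    and H: "openin (opens_space (sum_topology X I)) H" and U: "Sigma I U \<in> H"
  obtains K where "\<And>i. i \<in> I \<Longrightarrow> compactin (X i) (K i)" "\<And>i. i \<in> I \<Longrightarrow> K i \<subseteq> U i"
    "\<And>V. \<lbrakk>\<And>i. i \<in> I \<Longrightarrow> openin (X i) (V i); \<And>i. i \<in> I \<Longrightarrow> K i \<subseteq> V i\<rbrakk> \<Longrightarrow> Sigma I V \<in> H"
proof -
  obtain C where C: "C \<in> Box (sum_topology X I) (Sigma I U)"
    and C_H: "\<And>Q. \<lbrakk>openin (sum_topology X I) Q; C \<subseteq> Q\<rbrakk> \<Longrightarrow> Q \<in> H"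
    by (rule consonantE[OF cons H U]) blast
  let ?K = "\<lambda>i. {x \<in> topspace (X i). (i, x) \<in> C}"
  have C_topspace: "C \<subseteq> Sigma I (topspace \<circ> X)"
    using C compactin_subset_topspace[of "sum_topology X I" C] by (simp add: Box_def)
  show thesis
  proof
    show "compactin (X i) (?K i)" if "i \<in> I" for i
      using C that by (intro compactin_sum_topology_component) (auto simp: Box_def)
    show "?K i \<subseteq> U i" if "i \<in> I" for i using C by (auto simp: Box_def)
    show "Sigma I V \<in> H" if "\<And>i. i \<in> I \<Longrightarrow> openin (X i) (V i)" "\<And>i. i \<in> I \<Longrightarrow> ?K i \<subseteq> V i" for V
    proof (rule C_H)
      show "openin (sum_topology X I) (Sigma I V)"
        using that(1) by (simp add: openin_disjoint_union)
      show "C \<subseteq> Sigma I V" using C_topspace that(2) by fastforce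
    qed
  qed
qed

subsection \<open>The Vietoris topologies\<close>

lemma finite_intersection_of_relative_to_self:
  assumes "P T" and "\<And>A. P A \<Longrightarrow> A \<subseteq> T" and Int: "\<And>A B. \<lbrakk>P A; P B\<rbrakk> \<Longrightarrow> P (A \<inter> B)"
  shows "(finite intersection_of P relative_to T) = P"
proof (intro ext iffI)
  fix S assume "(finite intersection_of P relative_to T) S"
  then obtain F where F: "finite F" "F \<subseteq> Collect P" "S = T \<inter> \<Inter>F"
    unfolding relative_to_def intersection_of_def by blast
  have "P (T \<inter> \<Inter>F)"
    using F(1,2)
  proof (induction F rule: finite_induct)
    case empty
    then show ?case using \<open>P T\<close> by simp
  next
    case (insert A F)
    have "P (A \<inter> (T \<inter> \<Inter>F))" using insert by (blast intro: Int)
    moreover have "A \<inter> (T \<inter> \<Inter>F) = T \<inter> \<Inter>(insert A F)" by auto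
    ultimately show ?case by simp
  qed
  then show "P S" using F(3) by simp
next
  fix S assume "P S"
  then show "(finite intersection_of P relative_to T) S"
    using assms(2) by (intro relative_to_subset_inc finite_intersection_of_inc)
qed

lemma openin_upper_Vietoris_iff:
  "openin (upper_Vietoris X) W \<longleftrightarrow>
     (\<forall>K\<in>W. \<exists>U. openin X U \<and> K \<in> Box X U \<and> Box X U \<subseteq> W)"
proof -
  let ?box = "\<lambda>W. \<exists>U. openin X U \<and> W = Box X U" and ?T = "{K. compactin X K \<and> saturatedin X K}"
  have "(finite intersection_of ?box relative_to ?T) = ?box"
  proof (rule finite_intersection_of_relative_to_self)
    show "?box ?T"
      by (intro exI[of _ "topspace X"]) (auto simp: Box_def dest: compactin_subset_topspace)
    show "?box (A \<inter> B)" if "?box A" "?box B" for A B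
    proof -
      obtain U V where "openin X U" "openin X V" "A = Box X U" "B = Box X V"
        using \<open>?box A\<close> \<open>?box B\<close> by auto
      then have "openin X (U \<inter> V)" "A \<inter> B = Box X (U \<inter> V)" by (auto simp: Box_def)
      then show ?thesis by blast
    qed
  qed (auto simp: Box_def)
  then have "openin (upper_Vietoris X) W \<longleftrightarrow> (\<forall>K\<in>W. \<exists>A. ?box A \<and> K \<in> A \<and> A \<subseteq> W)"
    unfolding upper_Vietoris_def openin_subbase arbitrary_union_of_alt by (rule arg_cong)
  also have "\<dots> \<longleftrightarrow> (\<forall>K\<in>W. \<exists>U. openin X U \<and> K \<in> Box X U \<and> Box X U \<subseteq> W)" by blast
  finally show ?thesis .
qed

lemma openin_Box: "openin X U \<Longrightarrow> openin (upper_Vietoris X) (Box X U)"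
  unfolding openin_upper_Vietoris_iff by blast

lemma continuous_map_Box: "continuous_map (opens_space X) (opens_space (upper_Vietoris X)) (Box X)"
proof (rule continuous_map_opens_spaceI)
  fix D assume D: "directed_set D" "\<And>U. U \<in> D \<Longrightarrow> openin X U"
  have "\<exists>U\<in>D. K \<in> Box X U" if K: "K \<in> Box X (\<Union>D)" for K
  proof -
    have "openin (opens_space X) {U. openin X U \<and> K \<subseteq> U}"
      using K by (simp add: Box_def compactin_iff_openin_nbhds)
    moreover have "\<Union>D \<in> {U. openin X U \<and> K \<subseteq> U}" using K D(2) by (auto simp: Box_def)
    ultimately obtain U where "U \<in> D" "U \<in> {U. openin X U \<and> K \<subseteq> U}"
      using opens_space_directed[OF _ D] by blast
    then show ?thesis using K by (auto simp: Box_def)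
  qed
  then show "Box X (\<Union>D) = \<Union>(Box X ` D)" by (auto simp: Box_def)
qed (rule openin_Box)

lemma openin_Diamond:
  assumes "openin Y U"
  shows "openin (lower_Vietoris Y) (Diamond Y U)"
  unfolding lower_Vietoris_def openin_subbase
proof (rule arbitrary_union_of_inc, rule relative_to_subset_inc)
  show "(finite intersection_of (\<lambda>W. \<exists>U. openin Y U \<and> W = Diamond Y U)) (Diamond Y U)"
    using assms by (intro finite_intersection_of_inc) blast
qed (auto simp: Diamond_def)

lemma continuous_map_into_lower_VietorisI:
  assumes f: "\<And>x. x \<in> topspace Z \<Longrightarrow> closedin Y (f x)"
    and "\<And>U. openin Y U \<Longrightarrow> openin Z {x \<in> topspace Z. f x \<inter> U \<noteq> {}}"
  shows "continuous_map Z (lower_Vietoris Y) f"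
  unfolding continuous_map_into_topology_subbase_eq[OF lower_Vietoris_def]
proof (intro conjI allI impI)
  fix W assume "\<exists>U. openin Y U \<and> W = Diamond Y U"
  then obtain U where U: "openin Y U" "W = Diamond Y U" by blast
  then have "{x \<in> topspace Z. f x \<in> W} = {x \<in> topspace Z. f x \<inter> U \<noteq> {}}"
    using f by (auto simp: Diamond_def)
  then show "openin Z {x \<in> topspace Z. f x \<in> W}" using assms(2) U(1) by simp
qed (use f in auto)

subsection \<open>The comparison maps\<close>

lemma openin_alpha:
  assumes "closedin (opens_space X) \<AA>"
  shows "openin (upper_Vietoris X) (alpha X \<AA>)"
  using closedin_subset[OF assms] by (auto simp: alpha_def intro: openin_Box)

lemma closedin_beta: "closedin (opens_space X) (beta X \<U>)"
proof -
  have "closedin (opens_space X) {U \<in> topspace (opens_space X).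
      Box X U \<in> {\<V>. openin (upper_Vietoris X) \<V> \<and> \<V> \<subseteq> \<U>}}"
    using continuous_map_Box closedin_opens_space_subsets
    by (rule closedin_continuous_map_preimage)
  moreover have "beta X \<U> = {U \<in> topspace (opens_space X).
      Box X U \<in> {\<V>. openin (upper_Vietoris X) \<V> \<and> \<V> \<subseteq> \<U>}}"
    by (auto simp: beta_def openin_Box)
  ultimately show ?thesis by simp
qed

lemma alpha_beta:
  assumes "openin (upper_Vietoris X) \<U>"
  shows "alpha X (beta X \<U>) = \<U>"
proof
  show "\<U> \<subseteq> alpha X (beta X \<U>)"
    using assms unfolding openin_upper_Vietoris_iff alpha_def beta_def by blast
qed (auto simp: alpha_def beta_def)

lemma beta_alpha:
  assumes cons: "consonant X" and \<AA>: "closedin (opens_space X) \<AA>"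
  shows "beta X (alpha X \<AA>) = \<AA>"
proof
  have \<AA>_open: "\<AA> \<subseteq> {U. openin X U}" and compl: "openin (opens_space X) ({U. openin X U} - \<AA>)"
    using \<AA> by (auto simp: closedin_def)
  show "\<AA> \<subseteq> beta X (alpha X \<AA>)" using \<AA>_open by (auto simp: alpha_def beta_def)
  show "beta X (alpha X \<AA>) \<subseteq> \<AA>"
  proof (rule subsetI, rule ccontr)
    fix U assume U: "U \<in> beta X (alpha X \<AA>)" "U \<notin> \<AA>"
    then have "U \<in> {U. openin X U} - \<AA>" by (simp add: beta_def)
    then obtain K where K: "K \<in> Box X U" "\<And>V. \<lbrakk>openin X V; K \<subseteq> V\<rbrakk> \<Longrightarrow> V \<in> {U. openin X U} - \<AA>"
      by (rule consonantE[OF cons compl]) blast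
    then have "K \<in> alpha X \<AA>" using U(1) by (auto simp: beta_def)
    then obtain V where "V \<in> \<AA>" "K \<subseteq> V" by (auto simp: alpha_def Box_def)
    then show False using K(2)[of V] \<AA>_open by auto
  qed
qed

lemma continuous_map_beta:
  assumes cons: "consonant X"
  shows "continuous_map (opens_space (upper_Vietoris X)) (lower_Vietoris (opens_space X)) (beta X)"
proof (rule continuous_map_into_lower_VietorisI)
  fix H assume H: "openin (opens_space X) H"
  let ?O = "opens_space (upper_Vietoris X)"
  let ?K = "{K \<in> topspace (upper_Vietoris X). \<forall>V. openin X V \<and> K \<subseteq> V \<longrightarrow> V \<in> H}"
  have "beta X \<U> \<inter> H \<noteq> {} \<longleftrightarrow> ?K \<inter> \<U> \<noteq> {}" if \<U>: "openin (upper_Vietoris X) \<U>" for \<U>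
  proof
    assume "beta X \<U> \<inter> H \<noteq> {}"
    then obtain U where U: "U \<in> H" "Box X U \<subseteq> \<U>" by (auto simp: beta_def)
    obtain K where "K \<in> Box X U" "\<And>V. \<lbrakk>openin X V; K \<subseteq> V\<rbrakk> \<Longrightarrow> V \<in> H"
      using consonantE[OF cons H U(1)] by blast
    then show "?K \<inter> \<U> \<noteq> {}" using U(2) by (auto simp: Box_def)
  next
    assume "?K \<inter> \<U> \<noteq> {}"
    then obtain K where K: "K \<in> \<U>" "\<And>V. \<lbrakk>openin X V; K \<subseteq> V\<rbrakk> \<Longrightarrow> V \<in> H" by auto
    then obtain U where "openin X U" "K \<in> Box X U" "Box X U \<subseteq> \<U>"
      using \<U> unfolding openin_upper_Vietoris_iff by blast
    then show "beta X \<U> \<inter> H \<noteq> {}" using K(2)[of U] by (auto simp: beta_def Box_def)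
  qed
  then have "{\<U> \<in> topspace ?O. beta X \<U> \<inter> H \<noteq> {}} =
      (\<Union>K\<in>?K. {\<U>. openin (upper_Vietoris X) \<U> \<and> K \<in> \<U>})"
    by auto
  moreover have "openin ?O (\<Union>K\<in>?K. {\<U>. openin (upper_Vietoris X) \<U> \<and> K \<in> \<U>})"
    by (intro openin_Union) (auto intro: openin_opens_space_point_nbhds)
  ultimately show "openin ?O {\<U> \<in> topspace ?O. beta X \<U> \<inter> H \<noteq> {}}" by simp
qed (rule closedin_beta)

lemma consonant_sum_Box_shrinking:
  assumes cons: "consonant (sum_topology (\<lambda>_. X) I)"
    and W: "openin (opens_space (upper_Vietoris X)) W"
    and U: "\<And>i. i \<in> I \<Longrightarrow> openin X (U i)" "(\<Union>i\<in>I. Box X (U i)) \<in> W"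
  obtains K where "\<And>i. i \<in> I \<Longrightarrow> compactin X (K i)" "\<And>i. i \<in> I \<Longrightarrow> K i \<subseteq> U i"
    "\<And>V. \<lbrakk>\<And>i. i \<in> I \<Longrightarrow> openin X (V i); \<And>i. i \<in> I \<Longrightarrow> K i \<subseteq> V i\<rbrakk> \<Longrightarrow> (\<Union>i\<in>I. Box X (V i)) \<in> W"
proof -
  let ?S = "sum_topology (\<lambda>_. X) I"
  let ?f = "\<lambda>Q. \<Union>i\<in>I. Box X {x \<in> topspace X. (i, x) \<in> Q}"
  let ?H = "{Q \<in> topspace (opens_space ?S). ?f Q \<in> W}"
  have "continuous_map (opens_space ?S) (opens_space (upper_Vietoris X)) ?f"
  proof (rule continuous_map_opens_space_UN)
    fix i assume "i \<in> I"
    then have "continuous_map X ?S (Pair i)" by (rule continuous_map_component_injection)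
    from continuous_map_compose[OF continuous_map_opens_space_preimage[OF this] continuous_map_Box]
    show "continuous_map (opens_space ?S) (opens_space (upper_Vietoris X))
        (\<lambda>Q. Box X {x \<in> topspace X. (i, x) \<in> Q})"
      by (simp add: o_def)
  qed
  then have H: "openin (opens_space ?S) ?H" using W by (rule openin_continuous_map_preimage)
  have Sigma_H: "Sigma I V \<in> ?H \<longleftrightarrow> (\<Union>i\<in>I. Box X (V i)) \<in> W"
    if V: "\<And>i. i \<in> I \<Longrightarrow> openin X (V i)" for V
  proof -
    have "{x \<in> topspace X. (i, x) \<in> Sigma I V} = V i" if "i \<in> I" for i
      using openin_subset[OF V[OF that]] that by auto
    then show ?thesis using V by (simp add: openin_disjoint_union)
  qed
  have "Sigma I U \<in> ?H" using Sigma_H U by simp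
  then obtain K where K: "\<And>i. i \<in> I \<Longrightarrow> compactin X (K i)" "\<And>i. i \<in> I \<Longrightarrow> K i \<subseteq> U i"
    and K_H: "\<And>V. \<lbrakk>\<And>i. i \<in> I \<Longrightarrow> openin X (V i); \<And>i. i \<in> I \<Longrightarrow> K i \<subseteq> V i\<rbrakk> \<Longrightarrow> Sigma I V \<in> ?H"
    by (rule consonant_sum_shrinking[OF cons H]) blast
  show thesis
  proof (rule that[of K])
    show "(\<Union>i\<in>I. Box X (V i)) \<in> W"
      if V: "\<And>i. i \<in> I \<Longrightarrow> openin X (V i)" "\<And>i. i \<in> I \<Longrightarrow> K i \<subseteq> V i" for V
      using K_H[OF V] Sigma_H[OF V(1)] by simp
  qed (fact K)+
qed

lemma alpha_finite_subcover:
  assumes W: "openin (opens_space (upper_Vietoris X)) W"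
    and \<AA>: "\<And>U. U \<in> \<AA> \<Longrightarrow> openin X U" "alpha X \<AA> \<in> W"
  obtains I where "finite I" "I \<subseteq> \<AA>" "(\<Union>U\<in>I. Box X U) \<in> W"
proof -
  have "openin (upper_Vietoris X) C" if "C \<in> Box X ` \<AA>" for C
    using that \<AA>(1) openin_Box by blast
  then obtain F where "finite F" "F \<subseteq> Box X ` \<AA>" "\<Union>F \<in> W"
    using opens_space_finite_subcover[OF W] \<AA>(2) unfolding alpha_def by metis
  then show thesis using that finite_subset_image by metis
qed

lemma continuous_map_alpha:
  fixes X :: "'a topology"
  assumes cons: "\<And>I :: 'a set set. consonant (sum_topology (\<lambda>_. X) I)"
  shows "continuous_map (lower_Vietoris (opens_space X)) (opens_space (upper_Vietoris X)) (alpha X)"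
  unfolding continuous_map_def
proof (intro conjI allI impI)
  let ?L = "lower_Vietoris (opens_space X)"
  fix W assume W: "openin (opens_space (upper_Vietoris X)) W"
  have "\<exists>T. openin ?L T \<and> \<AA> \<in> T \<and> T \<subseteq> {\<AA> \<in> topspace ?L. alpha X \<AA> \<in> W}"
    if \<AA>: "closedin (opens_space X) \<AA>" and \<AA>_W: "alpha X \<AA> \<in> W" for \<AA>
  proof -
    have \<AA>_open: "openin X U" if "U \<in> \<AA>" for U using closedin_subset[OF \<AA>] that by auto
    then obtain I where I: "finite I" "I \<subseteq> \<AA>" "(\<Union>U\<in>I. Box X U) \<in> W"
      using alpha_finite_subcover[OF W _ \<AA>_W] by blast
    obtain K where K: "\<And>U. U \<in> I \<Longrightarrow> compactin X (K U)" "\<And>U. U \<in> I \<Longrightarrow> K U \<subseteq> U"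
      and K_W: "\<And>V. \<lbrakk>\<And>U. U \<in> I \<Longrightarrow> openin X (V U); \<And>U. U \<in> I \<Longrightarrow> K U \<subseteq> V U\<rbrakk>
        \<Longrightarrow> (\<Union>U\<in>I. Box X (V U)) \<in> W"
      by (rule consonant_sum_Box_shrinking[OF cons W, of I "\<lambda>U. U"]) (use I \<AA>_open in blast)+
    define N where "N U = {V. openin X V \<and> K U \<subseteq> V}" for U
    let ?T = "topspace ?L \<inter> \<Inter>((\<lambda>U. Diamond (opens_space X) (N U)) ` I)"
    have "openin ?L (Diamond (opens_space X) (N U))" if "U \<in> I" for U
      using K(1)[OF that] by (intro openin_Diamond) (simp add: N_def compactin_iff_openin_nbhds)
    then have "openin ?L ?T" using I(1) by (intro openin_Int_Inter openin_topspace) auto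
    moreover have "\<AA> \<in> ?T" using \<AA> I(2) K(2) \<AA>_open by (fastforce simp: Diamond_def N_def)
    moreover have "alpha X \<BB> \<in> W" if \<BB>: "\<BB> \<in> ?T" for \<BB>
    proof -
      have "\<forall>U\<in>I. \<exists>V. V \<in> \<BB> \<and> V \<in> N U" using \<BB> by (auto simp: Diamond_def)
      then obtain V where V: "\<And>U. U \<in> I \<Longrightarrow> V U \<in> \<BB> \<and> V U \<in> N U" by metis
      then have "(\<Union>U\<in>I. Box X (V U)) \<in> W" by (intro K_W) (auto simp: N_def)
      moreover have "(\<Union>U\<in>I. Box X (V U)) \<subseteq> alpha X \<BB>" using V by (auto simp: alpha_def)
      moreover have "openin (upper_Vietoris X) (alpha X \<BB>)" using \<BB> by (simp add: openin_alpha)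
      ultimately show ?thesis using opens_space_superset[OF W] by blast
    qed
    ultimately show ?thesis by blast
  qed
  then show "openin ?L {\<AA> \<in> topspace ?L. alpha X \<AA> \<in> W}" by (subst openin_subopen) auto
qed (auto simp: openin_alpha)

theorem theorem8p4:
  fixes X :: "'a topology"
  assumes "quasi_Polish_space X"
  shows "homeomorphic_maps (lower_Vietoris (opens_space X)) (opens_space (upper_Vietoris X))
           (alpha X) (beta X)"
proof -
  obtain d where d: "Smyth_complete_space X d"
    using assms unfolding quasi_Polish_space_def Smyth_complete_space_def
      Smyth_complete_space_axioms_def quasi_metric_space_def by blast
  have "consonant X" using d by (rule Smyth_complete_space.consonant)
  moreover have "consonant (sum_topology (\<lambda>_. X) I)" for I :: "'a set set"
    using Smyth_complete_space_sum[OF d] by (rule Smyth_complete_space.consonant)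
  ultimately show ?thesis
    unfolding homeomorphic_maps_def
    by (simp add: continuous_map_alpha continuous_map_beta beta_alpha alpha_beta)
qed

end
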